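(* Let $N$ be a positive integer and let $X_1,\dots,X_N$ be independent integer-valued random variables, each with finite support and each $\#$-log-concave. Let $X_1^{\#},\dots,X_N^{\#}$ be independent random variables, where $X_i^{\#}$ has probability mass function $f_i^{\#}$ ($f_i$ being the probability mass function of $X_i$). Then $$X_1+\cdots+X_N \prec X_1^{\#}+\cdots+X_N^{\#}.$$
   Context: For a finitely supported $f:\mathbb{Z}\to\mathbb{R}_+$ with support $\{x\in\mathbb{Z}: f(x)>0\}=\{x_0<x_1<\dots<x_n\}$ and $a_r=f(x_r)>0$, define $f^{\#}:\mathbb{Z}\to\mathbb{R}_+$ by $f^{\#}(r)=a_r$ for $r\in\{0,\dots,n\}$ and $f^{\#}=0$ elsewhere (a "squeezed" version of $f$ removing gaps in the support while keeping the order of values). $f$ is called $\#$-log-concave if $f^{\#}$ is log-concave, i.e. $f^{\#}(i)^2\ge f^{\#}(i-1)f^{\#}(i+1)$ for all $i\in\mathbb{Z}$; a random variable is $\#$-log-concave if its probability mass function is. Majorization: for finitely supported $f,g:\mathbb{Z}\to\mathbb{R}_+$, let $f^{[i]}$ denote the $i$-th largest value of $f$ (counted with multiplicity, values at points outside the support being $0$). Then $f\prec g$ means $\sum_{i=1}^k f^{[i]}\le\sum_{i=1}^k g^{[i]}$ for every $k\ge1$, with equality of the total sums $\sum_i f^{[i]}=\sum_i g^{[i]}$. For random variables, $X\prec Y$ means their probability mass functions satisfy this relation. *)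

theory Defs
  imports "HOL-Probability.Probability"
begin

definition supp :: "(int \<Rightarrow> real) \<Rightarrow> int set"
  where "supp f = {x. f x > 0}"

definition squeeze :: "(int \<Rightarrow> real) \<Rightarrow> int \<Rightarrow> real"
  where "squeeze f r =
    (if 0 \<le> r \<and> r < int (card (supp f))
     then f (sorted_list_of_set (supp f) ! nat r) else 0)"

definition log_concave :: "(int \<Rightarrow> real) \<Rightarrow> bool"
  where "log_concave f \<longleftrightarrow> (\<forall>i. (f i)\<^sup>2 \<ge> f (i - 1) * f (i + 1))"

definition sharp_log_concave :: "(int \<Rightarrow> real) \<Rightarrow> bool"
  where "sharp_log_concave f \<longleftrightarrow> log_concave (squeeze f)"

(* The positive values of f, one entry per point of the support, in decreasing order. *)
definition decreasing_values :: "(int \<Rightarrow> real) \<Rightarrow> real list"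
  where "decreasing_values f = rev (sort (map f (sorted_list_of_set (supp f))))"

(* The i-th largest value of f; ranks start at 1. Meaningful for nonnegative f with
   finite support, where the values beyond the support are 0. *)
definition ith_largest :: "(int \<Rightarrow> real) \<Rightarrow> nat \<Rightarrow> real"
  where "ith_largest f i =
    (if 1 \<le> i \<and> i \<le> length (decreasing_values f)
     then decreasing_values f ! (i - 1) else 0)"

(* The infinite sums have only finitely many nonzero terms. *)
definition majorized :: "(int \<Rightarrow> real) \<Rightarrow> (int \<Rightarrow> real) \<Rightarrow> bool"  (infix \<open>\<prec>\<close> 50)
  where "f \<prec> g \<longleftrightarrow>
    (\<forall>k\<ge>1. (\<Sum>i=1..k. ith_largest f i) \<le> (\<Sum>i=1..k. ith_largest g i)) \<and>
    (\<Sum>\<^sub>\<infinity>i\<in>{1..}. ith_largest f i) = (\<Sum>\<^sub>\<infinity>i\<in>{1..}. ith_largest g i)"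

definition mass_function :: "'a measure \<Rightarrow> ('a \<Rightarrow> int) \<Rightarrow> int \<Rightarrow> real"
  where "mass_function M X x = \<P>(\<omega> in M. X \<omega> = x)"

end

theory Submission
  imports Defs
begin

text \<open>
  Call a function a mixture of \<open>h\<close> if it is a convex combination of push-forwards of \<open>h\<close> along maps
  that are strictly increasing on the support of \<open>h\<close>. A mixture \<open>g\<close> of \<open>h\<close> satisfies \<open>g \<prec> h\<close>, and
  every \<open>f\<close> is a push-forward of its squeezed version. It remains to see that convolution preserves
  mixtures. By bilinearity, this concerns the convolution of the push-forwards of \<open>h\<close> along \<open>c\<close> and
  of \<open>k\<close> along \<open>d\<close>, the push-forward of \<open>(i, j) \<mapsto> h i * k j\<close> along \<open>(i, j) \<mapsto> c i + d j\<close>. By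
  log-concavity, the law of \<open>i\<close> given \<open>i + j = t\<close> increases stochastically with \<open>t\<close>, and so does the law
  of \<open>j\<close> (Efron). Its quantiles of a fixed level therefore form a lattice path
  \<open>t \<mapsto> (q t, t - q t)\<close> that is monotone in both coordinates, along which \<open>c i + d j\<close> is strictly
  increasing, and averaging over the level exhibits the convolution as a mixture of \<open>convolve h k\<close>.
\<close>

subsection \<open>Convolution and total positivity\<close>

definition nonneg_finite :: "(int \<Rightarrow> real) \<Rightarrow> bool"
  where "nonneg_finite f \<longleftrightarrow> (\<forall>x. 0 \<le> f x) \<and> finite (supp f)"

text \<open>Total positivity of order 2 of the kernel \<open>(x, z) \<mapsto> h (x - z)\<close>: this is log-concavity
  together with the absence of gaps in the support.\<close>

definition total_positive :: "(int \<Rightarrow> real) \<Rightarrow> bool"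
  where "total_positive h \<longleftrightarrow>
    (\<forall>x d e. 0 \<le> d \<longrightarrow> 0 \<le> e \<longrightarrow> h (x - e) * h (x + d) \<le> h x * h (x + d - e))"

definition convolve :: "(int \<Rightarrow> real) \<Rightarrow> (int \<Rightarrow> real) \<Rightarrow> int \<Rightarrow> real"
  where "convolve f g x = (\<Sum>y\<in>supp f. f y * g (x - y))"

definition push :: "(int \<Rightarrow> int) \<Rightarrow> (int \<Rightarrow> real) \<Rightarrow> int \<Rightarrow> real"
  where "push c h x = (\<Sum>t | t \<in> supp h \<and> c t = x. h t)"

inductive mixture :: "(int \<Rightarrow> real) \<Rightarrow> real \<Rightarrow> (int \<Rightarrow> real) \<Rightarrow> bool" for h
  where
    push: "strict_mono_on (supp h) c \<Longrightarrow> mixture h 1 (push c h)"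
  | combine: "mixture h r f \<Longrightarrow> mixture h s g \<Longrightarrow> 0 \<le> a \<Longrightarrow> 0 \<le> b \<Longrightarrow>
      mixture h (a * r + b * s) (\<lambda>x. a * f x + b * g x)"

lemma not_supp: "nonneg_finite f \<Longrightarrow> x \<notin> supp f \<Longrightarrow> f x = 0"
  by (auto simp: nonneg_finite_def supp_def order.antisym not_less)

lemma nonneg_finite_nonneg: "nonneg_finite f \<Longrightarrow> 0 \<le> f x"
  and nonneg_finite_finite: "nonneg_finite f \<Longrightarrow> finite (supp f)"
  by (auto simp: nonneg_finite_def)

lemma convolve_superset:
  assumes "nonneg_finite f" "finite K" "supp f \<subseteq> K"
  shows "convolve f g x = (\<Sum>y\<in>K. f y * g (x - y))"
  unfolding convolve_def
  by (rule sum.mono_neutral_left) (use assms not_supp in auto)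

lemma convolve_nonneg:
  assumes "nonneg_finite f" "nonneg_finite g"
  shows "0 \<le> convolve f g x"
  unfolding convolve_def by (intro sum_nonneg mult_nonneg_nonneg nonneg_finite_nonneg assms)

lemma supp_convolve:
  assumes "nonneg_finite f" "nonneg_finite g"
  shows "supp (convolve f g) = (\<lambda>(y, z). y + z) ` (supp f \<times> supp g)"
proof (intro equalityI subsetI)
  fix x assume "x \<in> supp (convolve f g)"
  then have "(\<Sum>y\<in>supp f. f y * g (x - y)) \<noteq> 0" by (simp add: supp_def convolve_def)
  then obtain y where y: "y \<in> supp f" "f y * g (x - y) \<noteq> 0" by (meson sum.neutral)
  then have "x - y \<in> supp g" using not_supp[OF assms(2)] by fastforce
  then show "x \<in> (\<lambda>(y, z). y + z) ` (supp f \<times> supp g)"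
    using y(1) by (force intro: image_eqI[where x = "(y, x - y)"])
next
  fix x assume "x \<in> (\<lambda>(y, z). y + z) ` (supp f \<times> supp g)"
  then obtain y where y: "y \<in> supp f" "x - y \<in> supp g" by auto
  have "0 < f y * g (x - y)" using y by (simp add: supp_def)
  also have "\<dots> \<le> convolve f g x"
    unfolding convolve_def
    by (rule member_le_sum)
      (use y assms in \<open>auto intro: mult_nonneg_nonneg nonneg_finite_nonneg nonneg_finite_finite\<close>)
  finally show "x \<in> supp (convolve f g)" by (simp add: supp_def)
qed

lemma nonneg_finite_convolve:
  "nonneg_finite f \<Longrightarrow> nonneg_finite g \<Longrightarrow> nonneg_finite (convolve f g)"
  using convolve_nonneg supp_convolve by (auto simp: nonneg_finite_def)

lemma total_positive_convolve:
  assumes f: "nonneg_finite f" "total_positive f" and g: "nonneg_finite g" "total_positive g"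
  shows "total_positive (convolve f g)"
  unfolding total_positive_def
proof (intro allI impI)
  fix x d e :: int assume d: "0 \<le> d" and e: "0 \<le> e"
  \<comment> \<open>One index set for all four values of the convolution, each written with shift 0
    or \<open>e\<close>.\<close>
  define K where "K = (\<Union>k\<in>{0, e}. (\<lambda>y. y + k) ` supp f)"
  have K: "finite K" unfolding K_def using nonneg_finite_finite[OF f(1)] by auto
  have cv: "convolve f g w = (\<Sum>a\<in>K. f (a - k) * g (w + k - a))" if "k \<in> {0, e}" for w k
  proof -
    have "convolve f g w = (\<Sum>a\<in>(\<lambda>y. y + k) ` supp f. f (a - k) * g (w + k - a))"
      unfolding convolve_def by (subst sum.reindex) (auto simp: inj_on_def)
    also have "\<dots> = (\<Sum>a\<in>K. f (a - k) * g (w + k - a))"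
    proof (rule sum.mono_neutral_left[OF K])
      show "(\<lambda>y. y + k) ` supp f \<subseteq> K" using that by (auto simp: K_def)
      have "a - k \<notin> supp f" if "a \<notin> (\<lambda>y. y + k) ` supp f" for a
        using that by (metis diff_add_cancel image_eqI)
      then show "\<forall>a\<in>K - (\<lambda>y. y + k) ` supp f. f (a - k) * g (w + k - a) = 0"
        using not_supp[OF f(1)] by auto
    qed
    finally show ?thesis .
  qed
  \<comment> \<open>Cauchy--Binet: the \<open>2 \<times> 2\<close> minor of the convolution is half the sum of the products of the
    minors \<open>P\<close> of \<open>f\<close> and \<open>Q\<close> of \<open>g\<close>.\<close>
  define P Q where "P a b = f (a - 0) * f (b - e) - f (b - 0) * f (a - e)"
    and "Q a b = g (x - a) * g (x + d - b) - g (x - b) * g (x + d - a)" for a b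
  have sign: "0 \<le> P a b * Q a b" if "a \<le> b" for a b
  proof -
    have "0 \<le> P a b"
      using f(2)[unfolded total_positive_def, rule_format, of "b - a" e a] that e
      by (simp add: P_def algebra_simps)
    moreover have "0 \<le> Q a b"
      using g(2)[unfolded total_positive_def, rule_format, of d "b - a" "x - a"] that d
      by (simp add: Q_def algebra_simps)
    ultimately show ?thesis by (simp add: zero_le_mult_iff)
  qed
  \<comment> \<open>Both minors change sign when \<open>a\<close> and \<open>b\<close> are swapped,
    so the case \<open>a \<le> b\<close> settles all pairs.\<close>
  have "P b a * Q b a = P a b * Q a b" for a b
    by (simp add: P_def Q_def algebra_simps)
  then have "0 \<le> P a b * Q a b" for a b
    using sign[of a b] sign[of b a] by (cases "a \<le> b") auto
  then have "0 \<le> (\<Sum>a\<in>K. \<Sum>b\<in>K. P a b * Q a b)"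
    by (intro sum_nonneg)
  \<comment> \<open>The redundant \<open>- 0\<close>, \<open>+ 0\<close> and \<open>- e + e\<close>
    bring the factors into the shape of \<open>cv\<close>.\<close>
  also have "\<dots> = (\<Sum>a\<in>K. \<Sum>b\<in>K.
      (f (a - 0) * g (x + 0 - a)) * (f (b - e) * g (x + d - e + e - b))
    + (f (a - e) * g (x + d - e + e - a)) * (f (b - 0) * g (x + 0 - b))
    - (f (a - 0) * g (x + d + 0 - a)) * (f (b - e) * g (x - e + e - b))
    - (f (a - e) * g (x - e + e - a)) * (f (b - 0) * g (x + d + 0 - b)))"
    by (intro sum.cong refl) (simp add: P_def Q_def algebra_simps)
  also have "\<dots> = 2 * (convolve f g x * convolve f g (x + d - e)
      - convolve f g (x - e) * convolve f g (x + d))"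
    unfolding sum_subtractf sum.distrib sum_product[symmetric]
    by (subst (1 2 3 4 5 6 7 8) cv[symmetric]) auto
  finally show "convolve f g (x - e) * convolve f g (x + d) \<le> convolve f g x * convolve f g (x + d - e)"
    by simp
qed

section \<open>Push-forwards, mixtures and bilinearity of convolution\<close>

lemma push_nonneg: "0 \<le> push c h x"
  unfolding push_def by (intro sum_nonneg) (auto simp: supp_def)

lemma supp_push_subset: "supp (push c h) \<subseteq> c ` supp h"
proof
  fix x assume "x \<in> supp (push c h)"
  then have "push c h x \<noteq> 0" by (auto simp: supp_def)
  then obtain t where "t \<in> {t. t \<in> supp h \<and> c t = x}"
    unfolding push_def by (meson sum.neutral)
  then show "x \<in> c ` supp h" by auto
qed

lemma nonneg_finite_push: "nonneg_finite h \<Longrightarrow> nonneg_finite (push c h)"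
  using push_nonneg supp_push_subset[of c h]
  by (auto simp: nonneg_finite_def intro: finite_subset)

lemma supp_combine_subset:
  assumes "nonneg_finite f" "nonneg_finite g"
  shows "supp (\<lambda>x. a * f x + b * g x) \<subseteq> supp f \<union> supp g"
proof
  fix x assume "x \<in> supp (\<lambda>x. a * f x + b * g x)"
  then have "a * f x + b * g x \<noteq> 0" by (auto simp: supp_def)
  then have "f x \<noteq> 0 \<or> g x \<noteq> 0" by auto
  then show "x \<in> supp f \<union> supp g" using not_supp assms by blast
qed

lemma nonneg_finite_combine:
  assumes "nonneg_finite f" "nonneg_finite g" "0 \<le> a" "0 \<le> b"
  shows "nonneg_finite (\<lambda>x. a * f x + b * g x)"
  using assms supp_combine_subset[OF assms(1,2), of a b]
  by (auto simp: nonneg_finite_def intro: finite_subset)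

lemma mixture_nonneg_finite: "mixture h r g \<Longrightarrow> nonneg_finite h \<Longrightarrow> nonneg_finite g"
  by (induction rule: mixture.induct) (auto intro: nonneg_finite_push nonneg_finite_combine)

text \<open>The left argument also fixes the range of summation, so all terms are first moved to a
  common set \<open>K\<close>; this relies on nonnegativity.\<close>

lemma convolve_combine_left:
  assumes "nonneg_finite f" "nonneg_finite g" "0 \<le> a" "0 \<le> b"
  shows "convolve (\<lambda>x. a * f x + b * g x) k x = a * convolve f k x + b * convolve g k x"
proof -
  define K where "K = supp f \<union> supp g"
  have K: "finite K" "supp f \<subseteq> K" "supp g \<subseteq> K"
    using assms by (auto simp: K_def nonneg_finite_finite)
  have "supp (\<lambda>x. a * f x + b * g x) \<subseteq> K"
    unfolding K_def by (rule supp_combine_subset[OF assms(1,2)])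
  with K show ?thesis
    by (simp add: convolve_superset[where K = K] nonneg_finite_combine assms
        sum_distrib_left sum.distrib[symmetric] algebra_simps)
qed

lemma convolve_combine_right:
  "convolve k (\<lambda>x. a * f x + b * g x) x = a * convolve k f x + b * convolve k g x"
  by (simp add: convolve_def sum_distrib_left sum.distrib[symmetric] algebra_simps)

lemma convolve_push_push:
  assumes "nonneg_finite h" "nonneg_finite k"
  shows "convolve (push c h) (push d k) x =
    (\<Sum>(i, j) | i \<in> supp h \<and> j \<in> supp k \<and> c i + d j = x. h i * k j)"
proof -
  note fin = nonneg_finite_finite[OF assms(1)] nonneg_finite_finite[OF assms(2)]
  have "convolve (push c h) (push d k) x =
      (\<Sum>y\<in>c ` supp h. push c h y * push d k (x - y))"
    by (intro convolve_superset supp_push_subset nonneg_finite_push assms finite_imageI fin)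
  also have "\<dots> = (\<Sum>y\<in>c ` supp h. \<Sum>i | i \<in> supp h \<and> c i = y. h i * push d k (x - c i))"
    unfolding push_def[of c] sum_distrib_right by (intro sum.cong) auto
  also have "\<dots> = (\<Sum>i\<in>supp h. h i * push d k (x - c i))"
    using fin(1) by (rule sum.image_gen[symmetric])
  also have "\<dots> = (\<Sum>i\<in>supp h. \<Sum>j | j \<in> supp k \<and> d j = x - c i. h i * k j)"
    unfolding push_def sum_distrib_left ..
  also have "\<dots> = (\<Sum>(i, j)\<in>(SIGMA i:supp h. {j. j \<in> supp k \<and> d j = x - c i}). h i * k j)"
    using fin by (intro sum.Sigma) auto
  also have "(SIGMA i:supp h. {j. j \<in> supp k \<and> d j = x - c i})
      = {(i, j). i \<in> supp h \<and> j \<in> supp k \<and> c i + d j = x}"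
    by (auto simp: algebra_simps)
  finally show ?thesis .
qed

subsection \<open>Stochastic monotonicity given the sum\<close>

text \<open>Up to the factor \<open>convolve h k t\<close>, the distribution function of the first
  summand given that the sum is \<open>t\<close>. Without division, the comparisons below also cover
  sums of mass 0.\<close>

definition cumulative :: "(int \<Rightarrow> real) \<Rightarrow> (int \<Rightarrow> real) \<Rightarrow> int \<Rightarrow> int \<Rightarrow> real"
  where "cumulative h k t i = (\<Sum>a | a \<in> supp h \<and> a \<le> i. h a * k (t - a))"

lemma cumulative_mono:
  assumes "nonneg_finite h" "nonneg_finite k" "i \<le> j"
  shows "cumulative h k t i \<le> cumulative h k t j"
  unfolding cumulative_def
  by (rule sum_mono2)
    (use assms nonneg_finite_finite[OF assms(1)] in
      \<open>auto intro: mult_nonneg_nonneg nonneg_finite_nonneg\<close>)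

lemma cumulative_nonneg:
  assumes "nonneg_finite h" "nonneg_finite k"
  shows "0 \<le> cumulative h k t i"
  unfolding cumulative_def by (intro sum_nonneg mult_nonneg_nonneg nonneg_finite_nonneg assms)

lemma cumulative_le_convolve:
  assumes "nonneg_finite h" "nonneg_finite k"
  shows "cumulative h k t i \<le> convolve h k t"
  unfolding cumulative_def convolve_def
  by (rule sum_mono2)
    (use assms nonneg_finite_finite[OF assms(1)] in
      \<open>auto intro: mult_nonneg_nonneg nonneg_finite_nonneg\<close>)

lemma cumulative_step:
  assumes "nonneg_finite h"
  shows "cumulative h k t i = cumulative h k t (i - 1) + h i * k (t - i)"
proof (cases "i \<in> supp h")
  case True
  then have "{a. a \<in> supp h \<and> a \<le> i} = insert i {a. a \<in> supp h \<and> a \<le> i - 1}" by auto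
  then show ?thesis
    using nonneg_finite_finite[OF assms] by (simp add: cumulative_def)
next
  case False
  then have "{a. a \<in> supp h \<and> a \<le> i} = {a. a \<in> supp h \<and> a \<le> i - 1}"
    by (auto simp: order.order_iff_strict)
  then show ?thesis
    using not_supp[OF assms False] by (simp add: cumulative_def)
qed

text \<open>Likelihood ratio order implies stochastic order, in cross-multiplied form. After
  splitting \<open>K\<close> at \<open>i\<close>, the products of two lower sums cancel and only
  pairs \<open>a \<le> i < b\<close> remain.\<close>

lemma partial_sum_cross_le:
  fixes p q :: "int \<Rightarrow> real"
  assumes K: "finite K" and "\<And>a b. a \<in> K \<Longrightarrow> b \<in> K \<Longrightarrow> a \<le> i \<Longrightarrow> i < b \<Longrightarrow> q a * p b \<le> p a * q b"
  shows "(\<Sum>a | a \<in> K \<and> a \<le> i. q a) * (\<Sum>a\<in>K. p a) \<le> (\<Sum>a | a \<in> K \<and> a \<le> i. p a) * (\<Sum>a\<in>K. q a)"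
proof -
  define L U where "L = {a. a \<in> K \<and> a \<le> i}" and "U = {a. a \<in> K \<and> i < a}"
  have "K = L \<union> U" "finite L" "finite U" "L \<inter> U = {}"
    using K by (auto simp: L_def U_def)
  then have split: "sum f K = sum f L + sum f U" for f :: "int \<Rightarrow> real"
    by (simp add: sum.union_disjoint)
  have "sum q L * sum p U \<le> sum p L * sum q U"
    unfolding sum_product using assms(2) by (intro sum_mono) (auto simp: L_def U_def)
  then show ?thesis
    unfolding L_def[symmetric] split by (simp add: algebra_simps)
qed

text \<open>A larger sum makes the first summand stochastically larger: by total positivity of
  \<open>k\<close>, the ratio of \<open>k (s - a)\<close> to \<open>k (t - a)\<close> increases with
  \<open>a\<close>.\<close>

lemma cumulative_antimono:
  assumes h: "nonneg_finite h" and k: "nonneg_finite k" "total_positive k" and "t \<le> s"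
  shows "cumulative h k s i * convolve h k t \<le> cumulative h k t i * convolve h k s"
  unfolding cumulative_def convolve_def
proof (rule partial_sum_cross_le)
  show "finite (supp h)" using nonneg_finite_finite[OF h] .
  fix a b :: int assume "a \<le> i" "i < b"
  then have "k (s - a) * k (t - b) \<le> k (t - a) * k (s - b)"
    using k(2)[unfolded total_positive_def, rule_format, of "s - t" "b - a" "t - a"] \<open>t \<le> s\<close>
    by (simp add: algebra_simps)
  then have "(h a * h b) * (k (s - a) * k (t - b)) \<le> (h a * h b) * (k (t - a) * k (s - b))"
    by (intro mult_left_mono mult_nonneg_nonneg nonneg_finite_nonneg h)
  then show "h a * k (s - a) * (h b * k (t - b)) \<le> h a * k (t - a) * (h b * k (s - b))"
    by (simp add: algebra_simps)
qed

text \<open>A larger sum makes the second summand stochastically larger, since \<open>i + d\<close>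
  out of \<open>t + d\<close> leaves the same remainder as \<open>i\<close> out of \<open>t\<close>.
  Reindexing by \<open>d\<close> equalizes the factors from \<open>k\<close>, and the ratio of
  \<open>h (a + d)\<close> to \<open>h a\<close> decreases with \<open>a\<close>.\<close>

lemma cumulative_shift:
  assumes h: "nonneg_finite h" "total_positive h" and k: "nonneg_finite k" and "0 \<le> d"
  shows "cumulative h k t i * convolve h k (t + d) \<le> cumulative h k (t + d) (i + d) * convolve h k t"
proof -
  define K where "K = supp h \<union> (\<lambda>a. a - d) ` supp h"
  have K: "finite K" using nonneg_finite_finite[OF h(1)] by (simp add: K_def)
  have zero: "h (a + d) = 0" if "a \<notin> (\<lambda>a. a - d) ` supp h" for a
    using that not_supp[OF h(1), of "a + d"] by (metis add_diff_cancel_right' image_eqI)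
  have conv: "convolve h k t = (\<Sum>a\<in>K. h a * k (t - a))"
    by (rule convolve_superset[OF h(1) K]) (simp add: K_def)
  have cum: "cumulative h k t i = (\<Sum>a | a \<in> K \<and> a \<le> i. h a * k (t - a))"
    unfolding cumulative_def
    by (rule sum.mono_neutral_left) (use K not_supp[OF h(1)] in \<open>auto simp: K_def\<close>)
  have "convolve h k (t + d) = (\<Sum>a\<in>(\<lambda>a. a - d) ` supp h. h (a + d) * k (t - a))"
    unfolding convolve_def by (subst sum.reindex) (auto simp: inj_on_def algebra_simps)
  also have "\<dots> = (\<Sum>a\<in>K. h (a + d) * k (t - a))"
    by (rule sum.mono_neutral_left[OF K]) (auto simp: K_def zero)
  finally have conv': "convolve h k (t + d) = (\<Sum>a\<in>K. h (a + d) * k (t - a))" .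
  have "cumulative h k (t + d) (i + d)
      = (\<Sum>a\<in>(\<lambda>a. a - d) ` {a. a \<in> supp h \<and> a \<le> i + d}. h (a + d) * k (t - a))"
    unfolding cumulative_def by (subst sum.reindex) (auto simp: inj_on_def algebra_simps)
  also have "\<dots> = (\<Sum>a | a \<in> K \<and> a \<le> i. h (a + d) * k (t - a))"
  proof (rule sum.mono_neutral_left)
    show "finite {a. a \<in> K \<and> a \<le> i}" using K by simp
    show "(\<lambda>a. a - d) ` {a. a \<in> supp h \<and> a \<le> i + d} \<subseteq> {a. a \<in> K \<and> a \<le> i}"
      by (auto simp: K_def)
    have "a \<notin> (\<lambda>a. a - d) ` supp h"
      if "a \<le> i" "a \<notin> (\<lambda>a. a - d) ` {a. a \<in> supp h \<and> a \<le> i + d}" for a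
      using that by force
    then show "\<forall>a\<in>{a. a \<in> K \<and> a \<le> i} - (\<lambda>a. a - d) ` {a. a \<in> supp h \<and> a \<le> i + d}.
        h (a + d) * k (t - a) = 0"
      using zero by auto
  qed
  finally have cum': "cumulative h k (t + d) (i + d) = (\<Sum>a | a \<in> K \<and> a \<le> i. h (a + d) * k (t - a))" .
  show ?thesis
    unfolding conv cum conv' cum'
  proof (rule partial_sum_cross_le[OF K])
    fix a b :: int assume "a \<le> i" "i < b"
    then have "h a * h (b + d) \<le> h (a + d) * h b"
      using h(2)[unfolded total_positive_def, rule_format, of d "b - a" b] \<open>0 \<le> d\<close>
      by (simp add: algebra_simps)
    then have "(k (t - a) * k (t - b)) * (h a * h (b + d)) \<le> (k (t - a) * k (t - b)) * (h (a + d) * h b)"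
      by (intro mult_left_mono mult_nonneg_nonneg nonneg_finite_nonneg k)
    then show "h a * k (t - a) * (h (b + d) * k (t - b)) \<le> h (a + d) * k (t - a) * (h b * k (t - b))"
      by (simp add: algebra_simps)
  qed
qed

text \<open>Supplies quantiles: for the predicate that a distribution function has reached level
  \<open>u\<close>, the threshold is the quantile of level \<open>u\<close>.\<close>

lemma int_threshold:
  fixes P :: "int \<Rightarrow> bool"
  assumes "\<And>i j. i \<le> j \<Longrightarrow> P i \<Longrightarrow> P j" "\<not> P lo" "P hi"
  obtains q where "\<And>i. P i \<longleftrightarrow> q \<le> i"
proof -
  define S where "S = {i \<in> {lo..hi}. P i}"
  have "finite S" by (rule finite_subset[of _ "{lo..hi}"]) (auto simp: S_def)
  moreover have "lo \<le> hi" using assms by (meson linear)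
  ultimately have S: "finite S" "hi \<in> S" using assms by (auto simp: S_def)
  have "P i \<longleftrightarrow> Min S \<le> i" for i
  proof
    assume "P i"
    show "Min S \<le> i"
    proof (cases "i \<le> hi")
      case True
      then have "i \<in> S" using \<open>P i\<close> assms(1,2) by (auto simp: S_def) (meson linear)
      then show ?thesis using S by simp
    next
      case False
      then show ?thesis using S by (meson Min_le linear order_trans)
    qed
  next
    assume "Min S \<le> i"
    moreover have "P (Min S)" using Min_in[OF S(1)] S by (auto simp: S_def)
    ultimately show "P i" using assms(1) by blast
  qed
  then show ?thesis using that by blast
qed

subsection \<open>Convolution of mixtures\<close>

text \<open>The starting point for accumulating paths, at level 0.\<close>

lemma mixture_zero: "mixture h 0 (\<lambda>_. 0)"
proof -
  have "mixture h 1 (push id h)" by (rule push) (simp add: strict_mono_on_def)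
  from combine[OF this this, of 0 0] show ?thesis by simp
qed

lemma mixture_convolve_push:
  assumes h: "nonneg_finite h" "total_positive h" and k: "nonneg_finite k" "total_positive k"
    and c: "strict_mono_on (supp h) c" and d: "strict_mono_on (supp k) d"
  shows "mixture (convolve h k) 1 (convolve (push c h) (push d k))"
proof -
  define W where "W = convolve h k"
  define F where "F t i = cumulative h k t i / W t" for t i
  define E where "E x = {(i, j). i \<in> supp h \<and> j \<in> supp k \<and> c i + d j = x}" for x
  define G where "G u x = (\<Sum>(i, j)\<in>E x. W (i + j) * (min u (F (i + j) i) - min u (F (i + j) (i - 1))))"
    for u x
  \<comment> \<open>For fixed \<open>t\<close>, \<open>F t\<close> is the distribution function of \<open>i\<close> given \<open>i + j = t\<close>. The quantiles of level
    \<open>u\<close> of all \<open>F t\<close> form a lattice path, and \<open>G u\<close> collects the paths of level at most \<open>u\<close>.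
    The path is constant between consecutive elements of \<open>B\<close>.\<close>
  define B where "B = {0, 1} \<union> (\<lambda>(i, j). F (i + j) i) ` (supp h \<times> supp k)
      \<union> (\<lambda>(i, j). F (i + j) (i - 1)) ` (supp h \<times> supp k)"
  note fin = nonneg_finite_finite[OF h(1)] nonneg_finite_finite[OF k(1)]
  have finE: "finite (E x)" for x
    by (rule finite_subset[of _ "supp h \<times> supp k"]) (use fin in \<open>auto simp: E_def\<close>)
  have W_nonneg: "0 \<le> W t" for t
    unfolding W_def by (rule convolve_nonneg[OF h(1) k(1)])
  have W_pos: "0 < W t" if "t \<in> supp W" for t using that by (simp add: supp_def)
  have suppW: "i + j \<in> supp W" if "i \<in> supp h" "j \<in> supp k" for i j
    unfolding W_def supp_convolve[OF h(1) k(1)] using that by force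
  \<comment> \<open>Where \<open>W t = 0\<close>, division yields \<open>F t i = 0\<close>, so these
    bounds hold for every \<open>t\<close>.\<close>
  have F01: "0 \<le> F t i" "F t i \<le> 1" for t i
    using cumulative_nonneg[OF h(1) k(1), of t i] cumulative_le_convolve[OF h(1) k(1), of t i]
      W_nonneg[of t]
    by (auto simp: F_def W_def[symmetric] divide_le_eq_1)
  have F_mono: "F t i \<le> F t j" if "i \<le> j" for t i j
    unfolding F_def by (intro divide_right_mono cumulative_mono that h k W_nonneg)
  have F_step: "F t i = F t (i - 1) + h i * k (t - i) / W t" for t i
    unfolding F_def by (subst cumulative_step[OF h(1)]) (simp add: add_divide_distrib)

  \<comment> \<open>No element of \<open>B\<close> lies strictly between \<open>v\<close> and
    \<open>u\<close>, so all levels above \<open>v\<close> and up to \<open>u\<close> share one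
    path, which enters with weight \<open>u - v\<close>.\<close>
  have lattice_path: "\<exists>p. strict_mono_on (supp W) p \<and> (\<forall>x. G u x = G v x + (u - v) * push p W x)"
    if uv: "0 \<le> v" "v < u" "u \<le> 1" and gap: "\<And>b. b \<in> B \<Longrightarrow> b \<le> v \<or> u \<le> b" for u v
  proof -
    \<comment> \<open>\<open>F t\<close> is 0 just below the support of \<open>h\<close> and 1 at
      its maximum, so the level \<open>u\<close> is crossed.\<close>
    have "\<exists>q. \<forall>i. u \<le> F t i \<longleftrightarrow> q \<le> i" if t: "t \<in> supp W" for t
    proof -
      have "{a. a \<in> supp h \<and> a \<le> Min (supp h) - 1} = {}"
        using Min_le[OF fin(1)] by force
      then have "F t (Min (supp h) - 1) = 0" by (simp only: F_def cumulative_def) simp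
      moreover have "{a. a \<in> supp h \<and> a \<le> Max (supp h)} = supp h" using fin(1) by auto
      then have "F t (Max (supp h)) = 1"
        using W_pos[OF t] by (simp only: F_def cumulative_def W_def convolve_def) simp
      ultimately show ?thesis
        using int_threshold[of "\<lambda>i. u \<le> F t i" "Min (supp h) - 1" "Max (supp h)"] uv F_mono
        by (smt (verit, best))
    qed
    then obtain q where q: "\<And>t i. t \<in> supp W \<Longrightarrow> u \<le> F t i \<longleftrightarrow> q t \<le> i" by metis
    define p where "p t = c (q t) + d (t - q t)" for t
    \<comment> \<open>\<open>F t\<close> jumps at \<open>q t\<close>, so there is mass at this point
      of the path. The path thus stays where \<open>c\<close> and \<open>d\<close> are strictly
      increasing.\<close>
    have q_supp: "q t \<in> supp h" "t - q t \<in> supp k" if "t \<in> supp W" for t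
    proof -
      have "F t (q t - 1) < F t (q t)" using q[OF that, of "q t"] q[OF that, of "q t - 1"] by auto
      then have "0 < h (q t) * k (t - q t) / W t" using F_step[of t "q t"] by simp
      then have "h (q t) \<noteq> 0" "k (t - q t) \<noteq> 0" by auto
      then show "q t \<in> supp h" "t - q t \<in> supp k" using not_supp h(1) k(1) by blast+
    qed
    \<comment> \<open>Normalized, \<open>cumulative_antimono\<close> moves the quantile to the right
      and \<open>cumulative_shift\<close> moves it by at most \<open>s - t\<close>.\<close>
    have q_mono: "q t \<le> q s \<and> t - q t \<le> s - q s" if ts: "t \<in> supp W" "s \<in> supp W" "t \<le> s" for t s
    proof
      note W = W_pos[OF ts(1)] W_pos[OF ts(2)]
      have "F s (q s) \<le> F t (q s)"
        using cumulative_antimono[OF h(1) k \<open>t \<le> s\<close>, of "q s"] W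
        by (simp add: F_def W_def[symmetric] field_simps)
      then show "q t \<le> q s" using q[OF ts(1), of "q s"] q[OF ts(2), of "q s"] by simp
      have "F t (q t) \<le> F s (q t + (s - t))"
        using cumulative_shift[OF h k(1), of "s - t" t "q t"] W \<open>t \<le> s\<close>
        by (simp add: F_def W_def[symmetric] field_simps)
      then have "q s \<le> q t + (s - t)"
        using q[OF ts(1), of "q t"] q[OF ts(2), of "q t + (s - t)"] by simp
      then show "t - q t \<le> s - q s" by simp
    qed
    have "strict_mono_on (supp W) p"
    proof (rule strict_mono_onI)
      fix t s assume ts: "t \<in> supp W" "s \<in> supp W" "t < s"
      note le = q_mono[OF ts(1,2)]
      have "c (q t) \<le> c (q s)" "d (t - q t) \<le> d (s - q s)"
        using le ts strict_mono_on_leD[OF c q_supp(1) q_supp(1)]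
          strict_mono_on_leD[OF d q_supp(2) q_supp(2)] by auto
      \<comment> \<open>The two coordinates add up to \<open>t\<close> and \<open>s\<close> with
        \<open>t < s\<close>, so at least one of them grows.\<close>
      moreover have "c (q t) < c (q s) \<or> d (t - q t) < d (s - q s)"
      proof (cases "q t < q s")
        case True
        then show ?thesis using strict_mono_onD[OF c q_supp(1) q_supp(1)] ts by blast
      next
        case False
        then have "t - q t < s - q s" using le ts by simp
        then show ?thesis using strict_mono_onD[OF d q_supp(2) q_supp(2)] ts by blast
      qed
      ultimately show "p t < p s" unfolding p_def by linarith
    qed
    moreover have "G u x = G v x + (u - v) * push p W x" for x
    proof -
      \<comment> \<open>Raising the cap from \<open>v\<close> to \<open>u\<close> leaves values up
        to \<open>v\<close> alone and adds \<open>u - v\<close> to those from \<open>u\<close>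
        on.\<close>
      have diff: "min u b - min v b = (u - v) * of_bool (u \<le> b)" if "b \<in> B" for b
        using gap[OF that] uv by auto
      have "G u x - G v x = (\<Sum>(i, j)\<in>E x. W (i + j) *
          ((min u (F (i + j) i) - min v (F (i + j) i))
            - (min u (F (i + j) (i - 1)) - min v (F (i + j) (i - 1)))))"
        unfolding G_def by (simp add: sum_subtractf[symmetric] case_prod_unfold algebra_simps)
      \<comment> \<open>The level \<open>u\<close> is reached at \<open>i\<close> but not at
        \<open>i - 1\<close> exactly when \<open>i\<close> is the quantile.\<close>
      also have "\<dots> = (\<Sum>(i, j)\<in>E x. if q (i + j) = i then (u - v) * W (i + j) else 0)"
      proof (rule sum.cong[OF refl], safe)
        fix i j assume "(i, j) \<in> E x"
        then have ij: "i \<in> supp h" "j \<in> supp k" by (auto simp: E_def)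
        then have "F (i + j) i \<in> B" "F (i + j) (i - 1) \<in> B" unfolding B_def by force+
        then show "W (i + j) * ((min u (F (i + j) i) - min v (F (i + j) i))
            - (min u (F (i + j) (i - 1)) - min v (F (i + j) (i - 1))))
          = (if q (i + j) = i then (u - v) * W (i + j) else 0)"
          by (simp add: diff q[OF suppW[OF ij]])
      qed
      also have "\<dots> = (\<Sum>(i, j) | (i, j) \<in> E x \<and> q (i + j) = i. (u - v) * W (i + j))"
        by (rule sum.mono_neutral_cong_right) (use finE in \<open>auto split: if_splits\<close>)
      also have "\<dots> = (\<Sum>t | t \<in> supp W \<and> p t = x. (u - v) * W t)"
        by (rule sum.reindex_bij_witness[where i = "\<lambda>t. (q t, t - q t)" and j = "\<lambda>(i, j). i + j"])
          (auto simp: E_def p_def suppW q_supp)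
      finally show ?thesis by (simp add: push_def sum_distrib_left)
    qed
    ultimately show ?thesis by blast
  qed

  have finB: "finite B" using fin by (simp add: B_def)
  have B01: "0 \<le> b" "b \<le> 1" if "b \<in> B" for b using that F01 by (auto simp: B_def)
  \<comment> \<open>Climb through the finite set \<open>B\<close> from 0, adding one weighted path
    between each level \<open>v\<close> and its successor \<open>u\<close>.\<close>
  have "mixture W u (G u)" if "u \<in> B" for u
    using that
  proof (induction "card {b \<in> B. b < u}" arbitrary: u rule: less_induct)
    case less
    show ?case
    proof (cases "u = 0")
      case True
      then have "G u = (\<lambda>_. 0)" using F01 by (simp add: G_def fun_eq_iff)
      then show ?thesis using mixture_zero True by simp
    next
      case False
      define v where "v = Max {b \<in> B. b < u}"
      have "0 \<in> {b \<in> B. b < u}" using False B01[OF less.prems] by (auto simp: B_def)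
      then have v: "v \<in> {b \<in> B. b < u}"
        unfolding v_def using finB by (intro Max_in) auto
      have v_max: "b \<le> v" if "b \<in> B" "b < u" for b
        unfolding v_def using finB that by simp
      have "mixture W v (G v)"
        using v finB by (intro less.hyps psubset_card_mono) auto
      moreover obtain p where "strict_mono_on (supp W) p"
        and G: "\<And>x. G u x = G v x + (u - v) * push p W x"
        using lattice_path[of v u] v v_max B01 less.prems by (metis (lifting) mem_Collect_eq not_less)
      ultimately have "mixture W (1 * v + (u - v) * 1) (\<lambda>x. 1 * G v x + (u - v) * push p W x)"
        using v by (intro combine push) auto
      moreover have "G u = (\<lambda>x. G v x + (u - v) * push p W x)" using G by (rule ext)
      ultimately show ?thesis by simp
    qed
  qed
  then have "mixture W 1 (G 1)" by (simp add: B_def)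
  \<comment> \<open>At level 1 the caps disappear, and \<open>W\<close> times a jump of
    \<open>F\<close> is the joint mass \<open>h i * k j\<close>.\<close>
  moreover have "G 1 x = convolve (push c h) (push d k) x" for x
  proof -
    have "W (i + j) * (min 1 (F (i + j) i) - min 1 (F (i + j) (i - 1))) = h i * k j"
      if "i \<in> supp h" "j \<in> supp k" for i j
    proof -
      have "min 1 (F (i + j) i) - min 1 (F (i + j) (i - 1)) = h i * k j / W (i + j)"
        unfolding min_absorb2[OF F01(2)] by (simp add: F_step[of "i + j" i])
      then show ?thesis using W_pos[OF suppW[OF that]] by simp
    qed
    then show ?thesis
      unfolding convolve_push_push[OF h(1) k(1)] G_def E_def by (intro sum.cong) auto
  qed
  then have "G 1 = convolve (push c h) (push d k)" by (rule ext)
  ultimately show ?thesis by (simp add: W_def)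
qed

text \<open>Nested induction on the two mixtures; the total weights multiply.\<close>

lemma mixture_convolve:
  assumes h: "nonneg_finite h" "total_positive h" and k: "nonneg_finite k" "total_positive k"
    and f: "mixture h r f" and g: "mixture k s g"
  shows "mixture (convolve h k) (r * s) (convolve f g)"
  using f
proof (induction rule: mixture.induct)
  case (push c)
  show ?case
    using g
  proof (induction rule: mixture.induct)
    case (push d)
    then show ?case using mixture_convolve_push[OF h k] \<open>strict_mono_on (supp h) c\<close> by simp
  next
    case (combine s1 g1 s2 g2 a b)
    then show ?case
      using mixture.combine[of "convolve h k" "1 * s1" "convolve (push c h) g1" "1 * s2"]
      unfolding convolve_combine_right by simp
  qed
next
  case (combine r1 f1 r2 f2 a b)
  have "convolve (\<lambda>x. a * f1 x + b * f2 x) g = (\<lambda>x. a * convolve f1 g x + b * convolve f2 g x)"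
    by (rule ext) (intro convolve_combine_left mixture_nonneg_finite[OF combine.hyps(1) h(1)]
          mixture_nonneg_finite[OF combine.hyps(2) h(1)] combine.hyps)
  then show ?case
    using mixture.combine[OF combine.IH combine.hyps(3,4)] by (simp add: algebra_simps)
qed

subsection \<open>Majorization by mixtures\<close>

text \<open>Replaces the sorted values by a list of points attaining them, so that sums of largest
  values become sums over sets of points.\<close>

lemma decreasing_values_listing:
  assumes "finite (supp f)"
  obtains L where "distinct L" "set L = supp f" "decreasing_values f = map f L"
    "\<And>i j. i \<le> j \<Longrightarrow> j < length L \<Longrightarrow> f (L ! j) \<le> f (L ! i)"
proof -
  define L where "L = rev (sort_key f (sorted_list_of_set (supp f)))"
  have "sort (map f (sorted_list_of_set (supp f))) = map f (sort_key f (sorted_list_of_set (supp f)))"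
    by (rule properties_for_sort) auto
  then have dv: "decreasing_values f = map f L"
    by (simp add: decreasing_values_def L_def rev_map)
  have "sorted_wrt (\<ge>) (map f L)"
    unfolding L_def rev_map[symmetric] sorted_wrt_rev by simp
  then have "f (L ! j) \<le> f (L ! i)" if "i \<le> j" "j < length L" for i j
    using that sorted_wrt_nth_less[of "(\<ge>)" "map f L" i j] by (cases "i = j") auto
  moreover have "distinct L" "set L = supp f" using assms by (auto simp: L_def)
  ultimately show ?thesis using dv that by blast
qed

lemma sum_ith_largest:
  assumes "distinct L" "decreasing_values f = map f L"
  shows "(\<Sum>i=1..k. ith_largest f i) = (\<Sum>x\<in>set (take k L). f x)"
proof (induction k)
  case (Suc k)
  then show ?case
    using assms by (cases "k < length L") (auto simp: ith_largest_def take_Suc_conv_app_nth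
        nth_eq_iff_index_eq in_set_conv_nth)
qed simp

text \<open>Exchange argument: a number \<open>m\<close> separates the values on the top
  \<open>k\<close> points \<open>T\<close> from those elsewhere, and \<open>A - T\<close> is
  compared with \<open>T - A\<close> through \<open>m\<close>.\<close>

lemma sum_le_sum_ith_largest:
  assumes f: "nonneg_finite f" and A: "finite A" "card A \<le> k"
  shows "(\<Sum>x\<in>A. f x) \<le> (\<Sum>i=1..k. ith_largest f i)"
proof -
  obtain L where L: "distinct L" "set L = supp f" "decreasing_values f = map f L"
    "\<And>i j. i \<le> j \<Longrightarrow> j < length L \<Longrightarrow> f (L ! j) \<le> f (L ! i)"
    using decreasing_values_listing nonneg_finite_finite[OF f] by metis
  \<comment> \<open>If \<open>k\<close> reaches the size of the support, \<open>T\<close> is the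
    whole support and 0 separates.\<close>
  define T m where "T = set (take k L)" and "m = (if k < length L then f (L ! k) else 0)"
  have m: "0 \<le> m" using nonneg_finite_nonneg[OF f] by (simp add: m_def)
  have small: "f x \<le> m" if "x \<notin> T" for x
  proof (cases "x \<in> supp f")
    case True
    then obtain i where i: "i < length L" "x = L ! i" using L(2) by (metis in_set_conv_nth)
    then have "k \<le> i" using that by (auto simp: T_def in_set_conv_nth not_less[symmetric])
    then show ?thesis using i L(4) by (auto simp: m_def)
  qed (use not_supp[OF f] m in auto)
  have large: "m \<le> f x" if "x \<in> T" for x
    using that L(4) nonneg_finite_nonneg[OF f] by (auto simp: m_def T_def in_set_conv_nth)
  have "card (A - T) * m \<le> card (T - A) * m"
  proof (cases "k < length L")
    case True
    then have "card T = k" using L(1) by (simp add: T_def distinct_card)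
    then have "card (A - T) \<le> card (T - A)"
      using A by (intro card_le_sym_Diff) (auto simp: T_def)
    then show ?thesis using m by (intro mult_right_mono) auto
  qed (simp add: m_def)
  moreover have "sum f (A - T) \<le> card (A - T) * m"
    using sum_bounded_above[of "A - T" f m] small by simp
  moreover have "card (T - A) * m \<le> sum f (T - A)"
    using sum_bounded_below[of "T - A" m f] large by simp
  ultimately have "sum f (A - T) \<le> sum f (T - A)" by simp
  moreover have "sum f A = sum f (A \<inter> T) + sum f (A - T)"
    using A by (intro sum.Int_Diff)
  moreover have "sum f T = sum f (A \<inter> T) + sum f (T - A)"
    by (subst Int_commute) (auto intro: sum.Int_Diff simp: T_def)
  ultimately show ?thesis unfolding sum_ith_largest[OF L(1,3)] T_def[symmetric] by simp
qed

text \<open>Together with the preceding bound, this makes the partial sum a maximum over sets of at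
  most \<open>k\<close> points, so majorization becomes a comparison of sums over sets.\<close>

lemma sum_ith_largest_attained:
  assumes "nonneg_finite f"
  obtains A where "finite A" "card A \<le> k" "(\<Sum>i=1..k. ith_largest f i) = (\<Sum>x\<in>A. f x)"
proof -
  obtain L where L: "distinct L" "decreasing_values f = map f L"
    using decreasing_values_listing nonneg_finite_finite[OF assms] by metis
  have "card (set (take k L)) \<le> k" using card_length[of "take k L"] by simp
  then show ?thesis using that[OF _ _ sum_ith_largest[OF L]] by simp
qed

lemma infsum_ith_largest:
  assumes "nonneg_finite f"
  shows "(\<Sum>\<^sub>\<infinity>i\<in>{1..}. ith_largest f i) = (\<Sum>x\<in>supp f. f x)"
proof -
  obtain L where L: "distinct L" "set L = supp f" "decreasing_values f = map f L"
    using decreasing_values_listing nonneg_finite_finite[OF assms] by metis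
  have "(\<Sum>\<^sub>\<infinity>i\<in>{1..}. ith_largest f i) = (\<Sum>\<^sub>\<infinity>i\<in>{1..length L}. ith_largest f i)"
    by (rule infsum_cong_neutral) (use L(3) in \<open>auto simp: ith_largest_def\<close>)
  also have "\<dots> = (\<Sum>i=1..length L. ith_largest f i)" by simp
  finally show ?thesis using sum_ith_largest[OF L(1,3), of "length L"] L(2) by simp
qed

text \<open>A strictly increasing map is injective, so at most \<open>card A\<close> points are sent
  into \<open>A\<close>, and their mass is bounded by the largest values of \<open>h\<close>.
  Nonnegative combinations preserve the bound.\<close>

lemma sum_mixture_le:
  assumes "mixture h r g" "nonneg_finite h" "finite A" "card A \<le> k"
  shows "(\<Sum>x\<in>A. g x) \<le> r * (\<Sum>i=1..k. ith_largest h i)"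
  using assms(1)
proof (induction rule: mixture.induct)
  case (push c)
  have fin: "finite (supp h)" using nonneg_finite_finite[OF assms(2)] .
  define S where "S = {t \<in> supp h. c t \<in> A}"
  have "sum (push c h) A = (\<Sum>x\<in>A. \<Sum>t | t \<in> S \<and> c t = x. h t)"
    unfolding push_def S_def by (intro sum.cong) auto
  also have "\<dots> = sum h S"
    using fin assms(3) by (intro sum.group) (auto simp: S_def)
  also have "\<dots> \<le> (\<Sum>i=1..k. ith_largest h i)"
  proof (rule sum_le_sum_ith_largest[OF assms(2)])
    show "finite S" using fin by (simp add: S_def)
    have "inj_on c S"
      using strict_mono_on_imp_inj_on[OF push] by (rule inj_on_subset) (auto simp: S_def)
    then have "card S \<le> card A" by (rule card_inj_on_le[OF _ _ assms(3)]) (auto simp: S_def)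
    then show "card S \<le> k" using assms(4) by simp
  qed
  finally show ?case by simp
next
  case (combine r f s g a b)
  have "(\<Sum>x\<in>A. a * f x + b * g x) = a * sum f A + b * sum g A"
    by (simp add: sum.distrib sum_distrib_left)
  also have "\<dots> \<le> a * (r * (\<Sum>i=1..k. ith_largest h i)) + b * (s * (\<Sum>i=1..k. ith_largest h i))"
    using combine by (intro add_mono mult_left_mono)
  finally show ?case by (simp add: algebra_simps)
qed

lemma majorized_mixture:
  fixes g h :: "int \<Rightarrow> real"
  assumes "mixture h 1 g" "nonneg_finite h" "(\<Sum>x\<in>supp g. g x) = (\<Sum>x\<in>supp h. h x)"
  shows "g \<prec> h"
proof -
  have g: "nonneg_finite g" using assms mixture_nonneg_finite by blast
  have "(\<Sum>i=1..k. ith_largest g i) \<le> (\<Sum>i=1..k. ith_largest h i)" for k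
  proof -
    obtain A where "finite A" "card A \<le> k" "(\<Sum>i=1..k. ith_largest g i) = (\<Sum>x\<in>A. g x)"
      using sum_ith_largest_attained[OF g] .
    then show ?thesis using sum_mixture_le[OF assms(1,2)] by simp
  qed
  then show ?thesis
    unfolding majorized_def infsum_ith_largest[OF g] infsum_ith_largest[OF assms(2)]
    using assms(3) by blast
qed

subsection \<open>Squeezing\<close>

lemma supp_squeeze:
  assumes "finite (supp f)"
  shows "supp (squeeze f) = {0..<int (card (supp f))}"
proof -
  have "0 < f (sorted_list_of_set (supp f) ! nat r)" if "0 \<le> r" "r < int (card (supp f))" for r
  proof -
    have "sorted_list_of_set (supp f) ! nat r \<in> set (sorted_list_of_set (supp f))"
      using that by (intro nth_mem) simp
    then show ?thesis using assms by (simp add: supp_def)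
  qed
  then show ?thesis by (auto simp: supp_def[of "squeeze f"] squeeze_def split: if_splits)
qed

lemma nonneg_finite_squeeze:
  assumes "nonneg_finite f"
  shows "nonneg_finite (squeeze f)"
  using assms supp_squeeze[OF nonneg_finite_finite[OF assms]]
  by (auto simp: nonneg_finite_def squeeze_def)

lemma mixture_squeeze:
  assumes f: "nonneg_finite f"
  shows "mixture (squeeze f) 1 f"
proof -
  define L where "L = sorted_list_of_set (supp f)"
  note fin = nonneg_finite_finite[OF f]
  have L: "distinct L" "set L = supp f" "length L = card (supp f)"
    using fin by (auto simp: L_def)
  have S: "supp (squeeze f) = {0..<int (length L)}"
    using supp_squeeze[OF fin] L by simp
  \<comment> \<open>Enumerating the support in increasing order undoes the squeezing.\<close>
  define c where "c r = L ! nat r" for r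
  have c: "strict_mono_on (supp (squeeze f)) c"
    unfolding S c_def
    using sorted_wrt_nth_less[OF strict_sorted_list_of_set[of "supp f"]]
    by (auto simp: L_def strict_mono_on_def)
  have "push c (squeeze f) x = f x" for x
  proof (cases "x \<in> supp f")
    case True
    then obtain i where i: "i < length L" "x = L ! i" using L(2) by (metis in_set_conv_nth)
    then have "{t. t \<in> supp (squeeze f) \<and> c t = x} = {int i}"
      using L(1) by (auto simp: S c_def nth_eq_iff_index_eq)
    then show ?thesis using i L(3) by (simp add: push_def squeeze_def L_def)
  next
    case False
    have "c t \<in> supp f" if "t \<in> supp (squeeze f)" for t
      using that unfolding S c_def L(2)[symmetric] by auto
    then have "{t. t \<in> supp (squeeze f) \<and> c t = x} = {}" using False by auto
    then show ?thesis using not_supp[OF f False] by (simp only: push_def) simp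
  qed
  then have "push c (squeeze f) = f" by (rule ext)
  then show ?thesis using push[OF c] by simp
qed

text \<open>Log-concavity alone would allow a support such as \<open>{0, 3}\<close>; an interval
  excludes this. \<open>step\<close> moves two points towards each other by one, and repeating it
  \<open>e\<close> times gives the general inequality.\<close>

lemma total_positive_log_concave:
  assumes h: "nonneg_finite h" "log_concave h" and S: "supp h = {0..<n}"
  shows "total_positive h"
proof -
  have step: "h x * h (x + int m + 1) \<le> h (x + 1) * h (x + int m)" for x m
  proof (induction m)
    case (Suc m)
    define y where "y = x + int m"
    have goal: "h x * h (y + 2) \<le> h (x + 1) * h (y + 1)"
    \<comment> \<open>If both outer points lie in the support, so do \<open>y\<close> and
      \<open>y + 1\<close>, and their positive values can be cancelled. Otherwise the left side is
      0.\<close>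
    proof (cases "x \<in> supp h \<and> y + 2 \<in> supp h")
      case True
      then have "y \<in> supp h" "y + 1 \<in> supp h" by (auto simp: S y_def)
      then have pos: "0 < h y" "0 < h (y + 1)" by (auto simp: supp_def)
      have lc: "h y * h (y + 2) \<le> (h (y + 1))\<^sup>2"
        using h(2)[unfolded log_concave_def, rule_format, of "y + 1"] by (simp add: algebra_simps)
      have "(h x * h (y + 2)) * (h y * h (y + 1)) = (h x * h (y + 1)) * (h y * h (y + 2))" by simp
      also have "\<dots> \<le> (h (x + 1) * h y) * (h (y + 1))\<^sup>2"
        using Suc lc unfolding y_def[symmetric]
        by (rule mult_mono) (simp_all add: nonneg_finite_nonneg[OF h(1)])
      also have "\<dots> = (h (x + 1) * h (y + 1)) * (h y * h (y + 1))"
        by (simp add: power2_eq_square)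
      finally show ?thesis using pos by simp
    next
      case False
      then show ?thesis using not_supp[OF h(1)] nonneg_finite_nonneg[OF h(1)] by auto
    qed
    then show ?case by (simp add: y_def algebra_simps)
  qed simp
  have "h (x - int e) * h (x + int d) \<le> h x * h (x + int d - int e)" for x d e
  proof (induction e arbitrary: d)
    case (Suc e)
    show ?case
    proof (cases d)
      case (Suc d')
      have "h (x - int (Suc e)) * h (x + int d) \<le> h (x - int e) * h (x + int d')"
        using step[of "x - int e - 1" "Suc (e + d')"] Suc by (simp add: algebra_simps)
      also have "\<dots> \<le> h x * h (x + int d' - int e)" by (rule Suc.IH)
      finally show ?thesis using Suc by (simp add: algebra_simps)
    qed simp
  qed simp
  then have "h (x - e) * h (x + d) \<le> h x * h (x + d - e)" if "0 \<le> d" "0 \<le> e" for x d e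
    using that by (metis zero_le_imp_eq_int)
  then show ?thesis by (simp add: total_positive_def)
qed

subsection \<open>Mass functions of sums\<close>

lemma nonneg_finite_mass_function:
  "finite (supp (mass_function M X)) \<Longrightarrow> nonneg_finite (mass_function M X)"
  by (simp add: nonneg_finite_def mass_function_def)

lemma measurable_int_sum:
  fixes X :: "'i \<Rightarrow> 'a \<Rightarrow> int"
  assumes "\<And>i. i \<in> I \<Longrightarrow> X i \<in> measurable M (count_space UNIV)"
  shows "(\<lambda>\<omega>. \<Sum>i\<in>I. X i \<omega>) \<in> measurable M (count_space UNIV)"
  using assms
proof (induction I rule: infinite_finite_induct)
  case (insert i I)
  have "(\<lambda>\<omega>. z + (\<Sum>i\<in>I. X i \<omega>)) \<in> measurable M (count_space UNIV)" for z
    by (rule measurable_compose[OF _ measurable_count_space]) (use insert in auto)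
  then have "(\<lambda>\<omega>. X i \<omega> + (\<Sum>i\<in>I. X i \<omega>)) \<in> measurable M (count_space UNIV)"
    by (rule measurable_compose_countable) (use insert in auto)
  then show ?case using insert by simp
qed auto

context prob_space
begin

text \<open>The exceptional set is a countable union of null events. This reduces events about
  \<open>X\<close> to finite unions over its support.\<close>

lemma AE_mass_function_supp:
  assumes "X \<in> measurable M (count_space UNIV)"
  shows "AE \<omega> in M. X \<omega> \<in> supp (mass_function M X)"
proof -
  have "AE \<omega> in M. \<forall>x. x \<notin> supp (mass_function M X) \<longrightarrow> X \<omega> \<noteq> x"
  proof (subst AE_all_countable, rule allI)
    fix x :: int
    show "AE \<omega> in M. x \<notin> supp (mass_function M X) \<longrightarrow> X \<omega> \<noteq> x"
    proof (cases "x \<in> supp (mass_function M X)")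
      case False
      then have "\<P>(\<omega> in M. X \<omega> = x) = 0"
        by (simp add: supp_def mass_function_def not_less measure_le_0_iff)
      moreover have "{\<omega> \<in> space M. X \<omega> = x} \<in> events"
        using assms by measurable
      ultimately have "AE \<omega> in M. \<not> X \<omega> = x"
        by (simp add: prob_eq_0)
      then show ?thesis by simp
    qed simp
  qed
  then show ?thesis by eventually_elim auto
qed

lemma sum_mass_function:
  assumes X: "X \<in> measurable M (count_space UNIV)" and fin: "finite (supp (mass_function M X))"
  shows "(\<Sum>x\<in>supp (mass_function M X). mass_function M X x) = 1"
proof -
  have "(\<Sum>x\<in>supp (mass_function M X). mass_function M X x)
      = prob (\<Union>x\<in>supp (mass_function M X). {\<omega> \<in> space M. X \<omega> = x})"
    unfolding mass_function_def
    by (rule finite_measure_finite_Union[symmetric])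
      (use fin X in \<open>auto simp: disjoint_family_on_def mass_function_def[symmetric]\<close>)
  also have "\<dots> = 1"
    by (rule prob_eq_1[THEN iffD2])
      (use AE_mass_function_supp[OF X] fin X in \<open>auto elim!: eventually_mono\<close>)
  finally show ?thesis .
qed

lemma mass_function_add:
  assumes ind: "indep_var (count_space UNIV) X (count_space UNIV) Y"
    and fin: "finite (supp (mass_function M X))"
  shows "mass_function M (\<lambda>\<omega>. X \<omega> + Y \<omega>) = convolve (mass_function M X) (mass_function M Y)"
proof
  fix x
  have X[measurable]: "X \<in> measurable M (count_space UNIV)"
    and Y[measurable]: "Y \<in> measurable M (count_space UNIV)"
    using ind by (auto dest: indep_var_rv1 indep_var_rv2)
  let ?S = "supp (mass_function M X)"
  have "mass_function M (\<lambda>\<omega>. X \<omega> + Y \<omega>) x = prob (\<Union>y\<in>?S. {\<omega> \<in> space M. X \<omega> = y \<and> Y \<omega> = x - y})"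
    unfolding mass_function_def[of _ "\<lambda>\<omega>. X \<omega> + Y \<omega>"]
    by (rule finite_measure_eq_AE) (use AE_mass_function_supp[OF X] fin in
      \<open>auto elim!: eventually_mono\<close>)
  also have "\<dots> = (\<Sum>y\<in>?S. \<P>(\<omega> in M. X \<omega> = y \<and> Y \<omega> = x - y))"
    by (rule finite_measure_finite_Union) (use fin in \<open>auto simp: disjoint_family_on_def\<close>)
  also have "\<dots> = convolve (mass_function M X) (mass_function M Y) x"
    unfolding convolve_def
  proof (rule sum.cong[OF refl])
    fix y
    show "\<P>(\<omega> in M. X \<omega> = y \<and> Y \<omega> = x - y) = mass_function M X y * mass_function M Y (x - y)"
      using indep_varD[OF ind, of "{y}" "{x - y}"]
      by (simp add: mass_function_def vimage_def Int_def conj_commute)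
  qed
  finally show "mass_function M (\<lambda>\<omega>. X \<omega> + Y \<omega>) x = convolve (mass_function M X) (mass_function M Y) x" .
qed

text \<open>The index blocks \<open>{Suc n}\<close> and \<open>{1..n}\<close> are disjoint, and
  measurable functions of independent blocks are independent.\<close>

lemma indep_var_Suc_sum:
  fixes X :: "nat \<Rightarrow> 'a \<Rightarrow> int"
  assumes ind: "indep_vars (\<lambda>_. count_space UNIV) X {1..N}" and "Suc n \<le> N"
  shows "indep_var (count_space UNIV) (X (Suc n)) (count_space UNIV) (\<lambda>\<omega>. \<Sum>i=1..n. X i \<omega>)"
proof -
  have "indep_var (PiM {Suc n} (\<lambda>_. count_space UNIV)) (\<lambda>\<omega>. restrict (\<lambda>i. X i \<omega>) {Suc n})
      (PiM {1..n} (\<lambda>_. count_space UNIV)) (\<lambda>\<omega>. restrict (\<lambda>i. X i \<omega>) {1..n})"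
    using \<open>Suc n \<le> N\<close> by (intro indep_var_restrict[OF ind]) auto
  moreover have "(\<lambda>g. g (Suc n)) \<in> measurable (PiM {Suc n} (\<lambda>_. count_space (UNIV :: int set))) (count_space UNIV)"
    by (rule measurable_component_singleton) simp
  moreover have "(\<lambda>g. \<Sum>i=1..n. g i) \<in> measurable (PiM {1..n} (\<lambda>_. count_space (UNIV :: int set))) (count_space UNIV)"
    by (intro measurable_int_sum measurable_component_singleton)
  ultimately have "indep_var (count_space UNIV) ((\<lambda>g. g (Suc n)) \<circ> (\<lambda>\<omega>. restrict (\<lambda>i. X i \<omega>) {Suc n}))
      (count_space UNIV) ((\<lambda>g. \<Sum>i=1..n. g i) \<circ> (\<lambda>\<omega>. restrict (\<lambda>i. X i \<omega>) {1..n}))"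
    by (rule indep_var_compose)
  then show ?thesis by (simp add: comp_def)
qed

end

theorem theorem1p4:
  fixes N :: nat
    and M :: "'a measure" and X :: "nat \<Rightarrow> 'a \<Rightarrow> int"
    and M' :: "'b measure" and Y :: "nat \<Rightarrow> 'b \<Rightarrow> int"
  assumes "N \<ge> 1"
    and "prob_space M"
    and "prob_space.indep_vars M (\<lambda>_. count_space UNIV) X {1..N}"
    and "\<And>i. i \<in> {1..N} \<Longrightarrow> finite (supp (mass_function M (X i)))"
    and "\<And>i. i \<in> {1..N} \<Longrightarrow> sharp_log_concave (mass_function M (X i))"
    and "prob_space M'"
    and "prob_space.indep_vars M' (\<lambda>_. count_space UNIV) Y {1..N}"
    and "\<And>i. i \<in> {1..N} \<Longrightarrow> mass_function M' (Y i) = squeeze (mass_function M (X i))"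
  shows "mass_function M (\<lambda>\<omega>. \<Sum>i=1..N. X i \<omega>) \<prec> mass_function M' (\<lambda>\<omega>. \<Sum>i=1..N. Y i \<omega>)"
proof -
  interpret M: prob_space M by fact
  interpret M': prob_space M' by fact
  define f g where "f n = mass_function M (\<lambda>\<omega>. \<Sum>i=1..n. X i \<omega>)"
    and "g n = mass_function M' (\<lambda>\<omega>. \<Sum>i=1..n. Y i \<omega>)" for n
  have one: "nonneg_finite (mass_function M (X i))" "nonneg_finite (mass_function M' (Y i))"
    "total_positive (mass_function M' (Y i))" "mixture (mass_function M' (Y i)) 1 (mass_function M (X i))"
    if i: "i \<in> {1..N}" for i
  proof -
    show X: "nonneg_finite (mass_function M (X i))"
      by (intro nonneg_finite_mass_function assms i)
    show Y: "nonneg_finite (mass_function M' (Y i))"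
      unfolding assms(8)[OF i] by (rule nonneg_finite_squeeze[OF X])
    show "mixture (mass_function M' (Y i)) 1 (mass_function M (X i))"
      unfolding assms(8)[OF i] by (rule mixture_squeeze[OF X])
    show "total_positive (mass_function M' (Y i))"
      using total_positive_log_concave[OF Y] assms(5)[OF i] supp_squeeze[OF assms(4)[OF i]]
      by (simp add: assms(8)[OF i] sharp_log_concave_def)
  qed
  \<comment> \<open>Finiteness and total positivity of \<open>g n\<close> are carried along because
    \<open>mixture_convolve\<close> requires them for the next summand.\<close>
  have all: "nonneg_finite (g n) \<and> total_positive (g n) \<and> mixture (g n) 1 (f n)"
    if "1 \<le> n" "n \<le> N" for n
    using that
  proof (induction n rule: nat_induct_at_least)
    case base
    then show ?case using one[of 1] by (simp add: f_def g_def)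
  next
    case (Suc n)
    then have n: "Suc n \<in> {1..N}" "Suc n \<le> N" by auto
    have f: "f (Suc n) = convolve (mass_function M (X (Suc n))) (f n)"
      using M.mass_function_add[OF M.indep_var_Suc_sum[OF assms(3) n(2)] assms(4)[OF n(1)]]
      by (simp add: f_def add.commute)
    have g: "g (Suc n) = convolve (mass_function M' (Y (Suc n))) (g n)"
      using M'.mass_function_add[OF M'.indep_var_Suc_sum[OF assms(7) n(2)]
          nonneg_finite_finite[OF one(2)[OF n(1)]]]
      by (simp add: g_def add.commute)
    show ?case
      using Suc one[OF n(1)] mixture_convolve[of _ "g n" 1 _ 1 "f n"] unfolding f g
      by (auto intro: nonneg_finite_convolve total_positive_convolve)
  qed
  then have N: "nonneg_finite (g N)" "mixture (g N) 1 (f N)" using assms(1) by auto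
  have X: "X i \<in> measurable M (count_space UNIV)" if "i \<in> {1..N}" for i
    using assms(3) that by (auto simp: M.indep_vars_def)
  have Y: "Y i \<in> measurable M' (count_space UNIV)" if "i \<in> {1..N}" for i
    using assms(7) that by (auto simp: M'.indep_vars_def)
  \<comment> \<open>Both totals are 1, which gives the equality of total sums in the
    majorization.\<close>
  have "(\<Sum>x\<in>supp (f N). f N x) = 1"
    unfolding f_def
  proof (rule M.sum_mass_function)
    show "finite (supp (mass_function M (\<lambda>\<omega>. \<Sum>i=1..N. X i \<omega>)))"
      using nonneg_finite_finite[OF mixture_nonneg_finite[OF N(2,1)]] by (simp add: f_def)
  qed (rule measurable_int_sum[OF X])
  moreover have "(\<Sum>x\<in>supp (g N). g N x) = 1"
    unfolding g_def
  proof (rule M'.sum_mass_function)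
    show "finite (supp (mass_function M' (\<lambda>\<omega>. \<Sum>i=1..N. Y i \<omega>)))"
      using nonneg_finite_finite[OF N(1)] by (simp add: g_def)
  qed (rule measurable_int_sum[OF Y])
  ultimately show ?thesis using majorized_mixture[OF N(2,1)] by (simp add: f_def g_def)
qed

end
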